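(* Assume $\Sigma^{(e)}\succ0$ for every $e\in\mathcal E$ and $\Sigma_{j,j}=1$ for every $j\in[d]$. Let $k\in[d]$, $\gamma\ge0$ and let $$\mathcal P_{\gamma,k}(\Sigma,u)=\Big\{(X,Y)\sim\mu:\ \mathbb E[XX^\top]=\Sigma,\ \ \big|\mathbb E[X_jY]-u_j\big|\le\gamma\cdot w_k(j)\ \ \forall j\in[d]\Big\}.$$ Then $\mathsf Q_{k,\gamma}$ has a unique minimizer $\beta^{k,\gamma}$ over $\mathbb R^d$, and $$\beta^{k,\gamma}=\arg\min_\beta\max_{\mu\in\mathcal P_{\gamma,k}(\Sigma,u)}\Big\{\mathbb E_{(X,Y)\sim\mu}\big[|Y-\beta^\top X|^2-|Y|^2\big]\Big\}.$$
   Context: $\mathcal E$ is a finite set of environments; for each $e\in\mathcal E$, $(X^{(e)},Y^{(e)})\in\mathbb R^d\times\mathbb R$ is a random pair with finite second moments. $\Sigma^{(e)}=\mathbb E[X^{(e)}(X^{(e)})^\top]$, $u^{(e)}=\mathbb E[X^{(e)}Y^{(e)}]$, $\Sigma=\frac1{|\mathcal E|}\sum_e\Sigma^{(e)}$, $u=\frac1{|\mathcal E|}\sum_eu^{(e)}$. For $S\subseteq[d]$, $\beta^{(e,S)}=\arg\min_{\mathrm{supp}(\beta)\subseteq S}\mathbb E[|Y^{(e)}-\beta^\top X^{(e)}|^2]$ and $\beta^{(S)}=\arg\min_{\mathrm{supp}(\beta)\subseteq S}\sum_{e}\mathbb E[|Y^{(e)}-\beta^\top X^{(e)}|^2]$.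 With $\|z\|_A=\sqrt{z^\top Az}$ and subscript $S$ denoting subvector / principal submatrix, define $$w_k(j)=\sqrt{\min_{S:\,j\in S,\,|S|\le k}\ \tfrac1{|\mathcal E|}\sum_{e\in\mathcal E}\|\beta_S^{(e,S)}-\beta_S^{(S)}\|^2_{\Sigma_S^{(e)}}},$$ $$\mathsf Q_{k,\gamma}(\beta)=\tfrac1{2|\mathcal E|}\sum_{e\in\mathcal E}\mathbb E[|Y^{(e)}-\beta^\top X^{(e)}|^2]+\gamma\sum_{j=1}^d|\beta_j|\,w_k(j).$$ *)

theory Defs
  imports "HOL-Probability.Probability"
begin

definition sq_integrable_pair ::
  "'a measure \<Rightarrow> ('a \<Rightarrow> real^'d) \<Rightarrow> ('a \<Rightarrow> real) \<Rightarrow> bool" where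
  "sq_integrable_pair M X Y \<longleftrightarrow>
     prob_space M \<and> X \<in> borel_measurable M \<and> Y \<in> borel_measurable M \<and>
     integrable M (\<lambda>\<omega>. (norm (X \<omega>))\<^sup>2) \<and> integrable M (\<lambda>\<omega>. (Y \<omega>)\<^sup>2)"

definition second_moment :: "'a measure \<Rightarrow> ('a \<Rightarrow> real^'d) \<Rightarrow> real^'d^'d" where
  "second_moment M X = (\<chi> i j. LINT \<omega>|M. X \<omega> $ i * X \<omega> $ j)"

definition cross_moment :: "'a measure \<Rightarrow> ('a \<Rightarrow> real^'d) \<Rightarrow> ('a \<Rightarrow> real) \<Rightarrow> real^'d" where
  "cross_moment M X Y = (\<chi> j. LINT \<omega>|M. X \<omega> $ j * Y \<omega>)"

definition sq_risk :: "'a measure \<Rightarrow> ('a \<Rightarrow> real^'d) \<Rightarrow> ('a \<Rightarrow> real) \<Rightarrow> real^'d \<Rightarrow> real" where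
  "sq_risk M X Y \<beta> = (LINT \<omega>|M. \<bar>Y \<omega> - \<beta> \<bullet> X \<omega>\<bar>\<^sup>2)"

definition pos_def_matrix :: "real^'d^'d \<Rightarrow> bool" where
  "pos_def_matrix A \<longleftrightarrow> transpose A = A \<and> (\<forall>x. x \<noteq> 0 \<longrightarrow> x \<bullet> (A *v x) > 0)"

definition vec_support :: "real^'d \<Rightarrow> 'd set" where
  "vec_support \<beta> = {j. \<beta> $ j \<noteq> 0}"

text \<open>The norm of the subvector \<open>z\<^sub>S\<close> with respect to the principal submatrix \<open>A\<^sub>S\<close>;
  the double sum writes out the restricted quadratic form, so that no
  vector type indexed by \<open>S\<close> is needed.\<close>

definition sub_norm :: "'d set \<Rightarrow> real^'d^'d \<Rightarrow> real^'d \<Rightarrow> real" where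
  "sub_norm S A z = sqrt (\<Sum>i\<in>S. \<Sum>l\<in>S. z $ i * A $ i $ l * z $ l)"

text \<open>Below, an environment \<open>e \<in> E\<close> is a sample space \<open>M e\<close> carrying the pair \<open>(X e, Y e)\<close>.\<close>

definition avg_second_moment ::
  "'e set \<Rightarrow> ('e \<Rightarrow> 'a measure) \<Rightarrow> ('e \<Rightarrow> 'a \<Rightarrow> real^'d) \<Rightarrow> real^'d^'d" where
  "avg_second_moment E M X = (1 / real (card E)) *\<^sub>R (\<Sum>e\<in>E. second_moment (M e) (X e))"

definition avg_cross_moment ::
  "'e set \<Rightarrow> ('e \<Rightarrow> 'a measure) \<Rightarrow> ('e \<Rightarrow> 'a \<Rightarrow> real^'d) \<Rightarrow> ('e \<Rightarrow> 'a \<Rightarrow> real) \<Rightarrow> real^'d" where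
  "avg_cross_moment E M X Y = (1 / real (card E)) *\<^sub>R (\<Sum>e\<in>E. cross_moment (M e) (X e) (Y e))"

text \<open>Both minimizers are unique when every second moment matrix is positive definite;
  otherwise \<^const>\<open>arg_min\<close> makes an arbitrary choice.\<close>

definition beta_env ::
  "('e \<Rightarrow> 'a measure) \<Rightarrow> ('e \<Rightarrow> 'a \<Rightarrow> real^'d) \<Rightarrow> ('e \<Rightarrow> 'a \<Rightarrow> real) \<Rightarrow> 'e \<Rightarrow> 'd set \<Rightarrow> real^'d" where
  "beta_env M X Y e S = arg_min (sq_risk (M e) (X e) (Y e)) (\<lambda>\<beta>. vec_support \<beta> \<subseteq> S)"

definition beta_pooled ::
  "'e set \<Rightarrow> ('e \<Rightarrow> 'a measure) \<Rightarrow> ('e \<Rightarrow> 'a \<Rightarrow> real^'d) \<Rightarrow> ('e \<Rightarrow> 'a \<Rightarrow> real) \<Rightarrow> 'd set \<Rightarrow> real^'d" where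
  "beta_pooled E M X Y S =
     arg_min (\<lambda>\<beta>. \<Sum>e\<in>E. sq_risk (M e) (X e) (Y e) \<beta>) (\<lambda>\<beta>. vec_support \<beta> \<subseteq> S)"

definition invariance_weight ::
  "'e set \<Rightarrow> ('e \<Rightarrow> 'a measure) \<Rightarrow> ('e \<Rightarrow> 'a \<Rightarrow> real^'d) \<Rightarrow> ('e \<Rightarrow> 'a \<Rightarrow> real) \<Rightarrow> nat \<Rightarrow> 'd \<Rightarrow> real" where
  "invariance_weight E M X Y k j =
     sqrt (Min ((\<lambda>S. (1 / real (card E)) *
                   (\<Sum>e\<in>E. (sub_norm S (second_moment (M e) (X e))
                              (beta_env M X Y e S - beta_pooled E M X Y S))\<^sup>2))
                ` {S. j \<in> S \<and> card S \<le> k}))"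

definition Q_obj ::
  "'e set \<Rightarrow> ('e \<Rightarrow> 'a measure) \<Rightarrow> ('e \<Rightarrow> 'a \<Rightarrow> real^'d) \<Rightarrow> ('e \<Rightarrow> 'a \<Rightarrow> real)
     \<Rightarrow> nat \<Rightarrow> real \<Rightarrow> real^'d \<Rightarrow> real" where
  "Q_obj E M X Y k \<gamma> \<beta> =
     1 / (2 * real (card E)) * (\<Sum>e\<in>E. sq_risk (M e) (X e) (Y e) \<beta>)
     + \<gamma> * (\<Sum>j\<in>UNIV. \<bar>\<beta> $ j\<bar> * invariance_weight E M X Y k j)"

text \<open>The law \<open>\<mu>\<close> of \<open>(X, Y)\<close> lives on the product space, with \<^const>\<open>fst\<close> and \<^const>\<open>snd\<close>
  as the coordinate random variables. As for the environments, finite second moments are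
  required; this also keeps the Bochner integrals in the moment constraints from defaulting to 0.\<close>

definition uncertainty_set ::
  "'e set \<Rightarrow> ('e \<Rightarrow> 'a measure) \<Rightarrow> ('e \<Rightarrow> 'a \<Rightarrow> real^'d) \<Rightarrow> ('e \<Rightarrow> 'a \<Rightarrow> real)
     \<Rightarrow> nat \<Rightarrow> real \<Rightarrow> ((real^'d) \<times> real) measure set" where
  "uncertainty_set E M X Y k \<gamma> =
     {\<mu>. sets \<mu> = sets borel \<and> sq_integrable_pair \<mu> fst snd \<and>
         second_moment \<mu> fst = avg_second_moment E M X \<and>
         (\<forall>j. \<bar>cross_moment \<mu> fst snd $ j - avg_cross_moment E M X Y $ j\<bar>
                \<le> \<gamma> * invariance_weight E M X Y k j)}"

definition excess_risk :: "real^'d \<Rightarrow> ((real^'d) \<times> real) measure \<Rightarrow> real" where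
  "excess_risk \<beta> \<mu> = (LINT z|\<mu>. (\<bar>snd z - \<beta> \<bullet> fst z\<bar>\<^sup>2 - \<bar>snd z\<bar>\<^sup>2))"

text \<open>The maximum of \<open>f\<close> over \<open>A\<close>, meaningful only where it is attained.\<close>

definition max_over :: "'b set \<Rightarrow> ('b \<Rightarrow> real) \<Rightarrow> real" where
  "max_over A f = (GREATEST v. v \<in> f ` A)"

end

theory Submission
  imports Defs
begin

text \<open>With \<open>m = E[X Y]\<close> under \<open>\<mu>\<close>, the excess risk is \<open>\<beta> \<bullet> \<Sigma> \<beta> - 2 (\<beta> \<bullet> m)\<close>, and \<open>m\<close> ranges over the box
  of half-widths \<open>\<gamma> w j\<close> around \<open>u\<close>. The maximum is attained at the corner
  \<open>m j = u j - sgn (\<beta> j) \<gamma> w j\<close> and is \<open>2 Q(\<beta>)\<close> up to a constant. Every \<open>m\<close> is realised by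
  taking \<open>X\<close> uniform on suitably scaled Cholesky columns of \<open>\<Sigma>\<close> and \<open>Y = a \<bullet> X\<close> with \<open>\<Sigma> a = m\<close>.
  Existence and uniqueness of the minimizer are coercivity and strict convexity of \<open>Q\<close>.\<close>

section \<open>Integrability of the moments and expansion of the squared risk\<close>

lemma borel_measurable_vec_nth_comp:
  fixes X :: "'a \<Rightarrow> real^'d"
  assumes "X \<in> borel_measurable M"
  shows "(\<lambda>\<omega>. X \<omega> $ i) \<in> borel_measurable M"
  using borel_measurable_inner[OF assms borel_measurable_const[of "axis i 1"]]
  by (simp add: inner_axis)

lemma integrable_moments:
  fixes X :: "'a \<Rightarrow> real^'d"
  assumes "sq_integrable_pair M X Y"
  shows "integrable M (\<lambda>\<omega>. X \<omega> $ i * X \<omega> $ j)"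
    and "integrable M (\<lambda>\<omega>. X \<omega> $ i * Y \<omega>)"
    and "integrable M (\<lambda>\<omega>. (Y \<omega>)\<^sup>2)"
proof -
  have X: "X \<in> borel_measurable M" and Y[measurable]: "Y \<in> borel_measurable M"
    and iX: "integrable M (\<lambda>\<omega>. (norm (X \<omega>))\<^sup>2)" and iY: "integrable M (\<lambda>\<omega>. (Y \<omega>)\<^sup>2)"
    using assms by (auto simp: sq_integrable_pair_def)
  have [measurable]: "(\<lambda>\<omega>. X \<omega> $ l) \<in> borel_measurable M" for l
    using X by (rule borel_measurable_vec_nth_comp)
  have nth: "\<bar>x $ l\<bar> \<le> norm x" for x :: "real^'d" and l
    by (rule component_le_norm_cart)
  show "integrable M (\<lambda>\<omega>. X \<omega> $ i * X \<omega> $ j)"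
    using iX
  proof (rule Bochner_Integration.integrable_bound)
    show "AE \<omega> in M. norm (X \<omega> $ i * X \<omega> $ j) \<le> norm ((norm (X \<omega>))\<^sup>2)"
      by (intro AE_I2) (simp add: abs_mult power2_eq_square mult_mono nth)
  qed simp
  show "integrable M (\<lambda>\<omega>. X \<omega> $ i * Y \<omega>)"
    using Bochner_Integration.integrable_add[OF iX iY]
  proof (rule Bochner_Integration.integrable_bound)
    have "\<bar>x $ i\<bar> * \<bar>y\<bar> \<le> (norm x)\<^sup>2 + y\<^sup>2" for x :: "real^'d" and y :: real
    proof -
      have "\<bar>x $ i\<bar> * \<bar>y\<bar> \<le> norm x * \<bar>y\<bar>"
        by (intro mult_right_mono nth) auto
      \<comment> \<open>Twice the product is at most the sum of the squares, so the product, being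
        nonnegative, is too. This sum is the integrable dominating function.\<close>
      also have "\<dots> \<le> (norm x)\<^sup>2 + y\<^sup>2"
        using sum_squares_bound[of "norm x" "\<bar>y\<bar>"] mult_nonneg_nonneg[OF norm_ge_zero[of x] abs_ge_zero[of y]]
        unfolding power2_abs mult.assoc by linarith
      finally show ?thesis .
    qed
    then show "AE \<omega> in M. norm (X \<omega> $ i * Y \<omega>) \<le> norm ((norm (X \<omega>))\<^sup>2 + (Y \<omega>)\<^sup>2)"
      by (intro AE_I2) (simp add: abs_mult)
  qed simp
  show "integrable M (\<lambda>\<omega>. (Y \<omega>)\<^sup>2)" by (rule iY)
qed

lemma inner_matrix_vector_expand:
  fixes A :: "real^'d^'d"
  shows "x \<bullet> (A *v y) = (\<Sum>i\<in>UNIV. \<Sum>j\<in>UNIV. x $ i * y $ j * A $ i $ j)"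
  by (simp add: inner_vec_def matrix_vector_mult_def sum_distrib_left mult_ac)

text \<open>Subtracting the square of \<open>Y\<close> cancels the only term that is not determined
  by the second and cross moments. The formula serves twice: for the environments, through
  \<open>sq_risk_eq\<close>, and for the laws in the uncertainty set, through
  \<open>excess_risk_eq\<close>.\<close>

lemma excess_integral:
  fixes X :: "'a \<Rightarrow> real^'d"
  assumes "sq_integrable_pair M X Y"
  shows "integrable M (\<lambda>\<omega>. \<bar>Y \<omega> - \<beta> \<bullet> X \<omega>\<bar>\<^sup>2 - \<bar>Y \<omega>\<bar>\<^sup>2)"
    and "(LINT \<omega>|M. \<bar>Y \<omega> - \<beta> \<bullet> X \<omega>\<bar>\<^sup>2 - \<bar>Y \<omega>\<bar>\<^sup>2)
      = \<beta> \<bullet> (second_moment M X *v \<beta>) - 2 * (\<beta> \<bullet> cross_moment M X Y)"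
proof -
  note int = integrable_moments[OF assms]
  \<comment> \<open>Written in coordinates, the integrand is a finite linear combination of the
    products treated in \<open>integrable_moments\<close>, so linearity of the integral finishes
    both claims.\<close>
  have pointwise: "(\<lambda>\<omega>. \<bar>Y \<omega> - \<beta> \<bullet> X \<omega>\<bar>\<^sup>2 - \<bar>Y \<omega>\<bar>\<^sup>2) =
      (\<lambda>\<omega>. (\<Sum>i\<in>UNIV. \<Sum>j\<in>UNIV. \<beta> $ i * \<beta> $ j * (X \<omega> $ i * X \<omega> $ j))
         - 2 * (\<Sum>i\<in>UNIV. \<beta> $ i * (X \<omega> $ i * Y \<omega>)))"
  proof
    fix \<omega>
    have "(\<beta> \<bullet> X \<omega>)\<^sup>2 = (\<Sum>i\<in>UNIV. \<Sum>j\<in>UNIV. \<beta> $ i * \<beta> $ j * (X \<omega> $ i * X \<omega> $ j))"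
      by (simp add: power2_eq_square inner_vec_def sum_product mult_ac)
    moreover have "(\<beta> \<bullet> X \<omega>) * Y \<omega> = (\<Sum>i\<in>UNIV. \<beta> $ i * (X \<omega> $ i * Y \<omega>))"
      by (simp add: inner_vec_def sum_distrib_right mult.assoc)
    ultimately show "\<bar>Y \<omega> - \<beta> \<bullet> X \<omega>\<bar>\<^sup>2 - \<bar>Y \<omega>\<bar>\<^sup>2 =
        (\<Sum>i\<in>UNIV. \<Sum>j\<in>UNIV. \<beta> $ i * \<beta> $ j * (X \<omega> $ i * X \<omega> $ j))
         - 2 * (\<Sum>i\<in>UNIV. \<beta> $ i * (X \<omega> $ i * Y \<omega>))"
      by (simp add: power2_diff algebra_simps)
  qed
  show "integrable M (\<lambda>\<omega>. \<bar>Y \<omega> - \<beta> \<bullet> X \<omega>\<bar>\<^sup>2 - \<bar>Y \<omega>\<bar>\<^sup>2)"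
    unfolding pointwise
    by (intro Bochner_Integration.integrable_diff Bochner_Integration.integrable_sum
        integrable_mult_right int)
  show "(LINT \<omega>|M. \<bar>Y \<omega> - \<beta> \<bullet> X \<omega>\<bar>\<^sup>2 - \<bar>Y \<omega>\<bar>\<^sup>2)
      = \<beta> \<bullet> (second_moment M X *v \<beta>) - 2 * (\<beta> \<bullet> cross_moment M X Y)"
    unfolding pointwise inner_matrix_vector_expand
    by (simp add: int Bochner_Integration.integral_diff Bochner_Integration.integral_sum
        Bochner_Integration.integrable_sum second_moment_def cross_moment_def inner_vec_def)
qed

lemma sq_risk_eq:
  fixes X :: "'a \<Rightarrow> real^'d"
  assumes "sq_integrable_pair M X Y"
  shows "sq_risk M X Y \<beta> = \<beta> \<bullet> (second_moment M X *v \<beta>) - 2 * (\<beta> \<bullet> cross_moment M X Y)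
      + (LINT \<omega>|M. (Y \<omega>)\<^sup>2)"
proof -
  have "sq_risk M X Y \<beta> = (LINT \<omega>|M. (\<bar>Y \<omega> - \<beta> \<bullet> X \<omega>\<bar>\<^sup>2 - \<bar>Y \<omega>\<bar>\<^sup>2) + (Y \<omega>)\<^sup>2)"
    by (simp add: sq_risk_def)
  then show ?thesis
    using Bochner_Integration.integral_add[OF excess_integral(1)[OF assms, of \<beta>]
        integrable_moments(3)[OF assms]]
    by (simp add: excess_integral(2)[OF assms, unfolded power2_abs])
qed

section \<open>Factorisation of a positive definite matrix and laws with prescribed moments\<close>

lemma transpose_sym_nth:
  assumes "transpose A = A"
  shows "A $ i $ j = A $ j $ i"
  using assms by (metis transpose_def vec_lambda_beta)

text \<open>Cholesky elimination: subtracting the normalised outer square of the pivot row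
  \<open>A $ j\<close> leaves a form whose value at \<open>x\<close> is that of \<open>A\<close> at \<open>x - t *\<^sub>R axis j 1\<close> with the
  minimising \<open>t\<close>, so definiteness survives on the remaining coordinates.\<close>

lemma rank_one_decomposition_on:
  fixes A :: "real^'d^'d"
  assumes "finite S" and "transpose A = A"
    and "\<And>x. x \<noteq> 0 \<Longrightarrow> vec_support x \<subseteq> S \<Longrightarrow> x \<bullet> (A *v x) > 0"
    and "\<And>i j. i \<notin> S \<Longrightarrow> A $ i $ j = 0"
  shows "\<exists>v :: 'd \<Rightarrow> real^'d. \<forall>i j. A $ i $ j = (\<Sum>l\<in>S. v l $ i * v l $ j)"
  using assms
proof (induction S arbitrary: A rule: finite_induct)
  \<comment> \<open>With no coordinate left, the vanishing rows force the matrix to be zero, which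
    matches the empty sum.\<close>
  case empty
  then show ?case by auto
next
  case (insert p S)
  note sym = transpose_sym_nth[OF insert.prems(1)]
  have axis: "axis p 1 \<bullet> (A *v x) = A $ p \<bullet> x" "x \<bullet> (A *v axis p 1) = A $ p \<bullet> x" for x
    using sym by (simp_all add: inner_axis' matrix_vector_mul_component matrix_vector_mult_basis)
      (simp add: column_def inner_vec_def mult.commute)
  have "axis p 1 \<bullet> (A *v axis p 1) > 0"
    by (rule insert.prems(2)) (auto simp: vec_support_def axis_def vec_eq_iff)
  then have pos: "A $ p $ p > 0"
    by (simp add: axis inner_axis)
  define v where "v = (1 / sqrt (A $ p $ p)) *\<^sub>R A $ p"
  define B :: "real^'d^'d" where "B = (\<chi> i j. A $ i $ j - v $ i * v $ j)"
  have vv: "v $ i * v $ j = A $ p $ i * A $ p $ j / A $ p $ p" for i j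
    using pos by (simp add: v_def field_simps)
  have "\<exists>w :: 'd \<Rightarrow> real^'d. \<forall>i j. B $ i $ j = (\<Sum>l\<in>S. w l $ i * w l $ j)"
  proof (rule insert.IH)
    show "transpose B = B"
      using sym by (simp add: B_def transpose_def vec_eq_iff mult.commute)
    \<comment> \<open>Row \<open>p\<close> is cleared by the choice of \<open>v\<close>. Any other
      row outside \<open>S\<close> already vanishes in \<open>A\<close>, and by symmetry
      \<open>v $ i\<close> vanishes with it.\<close>
    show "B $ i $ j = 0" if "i \<notin> S" for i j
    proof (cases "i = p")
      case True
      then show ?thesis using pos by (simp add: B_def vv)
    next
      case False
      then have "A $ i $ l = 0" for l using that insert.prems(3) by simp
      moreover from this have "A $ p $ i = 0" using sym by metis
      ultimately show ?thesis by (simp add: B_def vv)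
    qed
    show "x \<bullet> (B *v x) > 0" if "x \<noteq> 0" and supp: "vec_support x \<subseteq> S" for x
    proof -
      define t where "t = (A $ p \<bullet> x) / A $ p $ p"
      define y where "y = x - t *\<^sub>R axis p 1"
      \<comment> \<open>The vector \<open>y\<close> differs from \<open>x\<close> only in coordinate
        \<open>p\<close>, where \<open>x\<close> is zero; the nonzero coordinates of
        \<open>x\<close> therefore survive in \<open>y\<close>.\<close>
      have "x $ p = 0" using supp insert.hyps by (auto simp: vec_support_def)
      with \<open>x \<noteq> 0\<close> have "y \<noteq> 0"
        by (auto simp: y_def vec_eq_iff axis_def split: if_splits)
      moreover have "vec_support y \<subseteq> insert p S"
        using supp by (auto simp: y_def vec_support_def axis_def)
      ultimately have "0 < y \<bullet> (A *v y)"
        by (rule insert.prems(2))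
      also have "y \<bullet> (A *v y) = x \<bullet> (A *v x) - 2 * t * (A $ p \<bullet> x) + t\<^sup>2 * A $ p $ p"
        by (simp add: y_def matrix_vector_mult_diff_distrib matrix_vector_mult_scaleR
            inner_diff_left inner_diff_right axis inner_axis power2_eq_square algebra_simps)
      also have "\<dots> = x \<bullet> (A *v x) - (A $ p \<bullet> x)\<^sup>2 / A $ p $ p"
        using pos by (simp add: t_def power2_eq_square field_simps)
      also have "(A $ p \<bullet> x)\<^sup>2 / A $ p $ p = (v \<bullet> x)\<^sup>2"
        using pos by (simp add: v_def power_mult_distrib power_divide)
      also have "x \<bullet> (A *v x) - (v \<bullet> x)\<^sup>2 = x \<bullet> (B *v x)"
        proof -
          have "(v \<bullet> x)\<^sup>2 = (\<Sum>i\<in>UNIV. \<Sum>j\<in>UNIV. x $ i * x $ j * (v $ i * v $ j))"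
            by (simp add: power2_eq_square inner_vec_def sum_product mult_ac)
          then show ?thesis
            unfolding inner_matrix_vector_expand
            by (simp add: B_def right_diff_distrib sum_subtractf)
        qed
      finally show ?thesis .
    qed
  qed
  then obtain w :: "'d \<Rightarrow> real^'d" where w: "\<And>i j. B $ i $ j = (\<Sum>l\<in>S. w l $ i * w l $ j)"
    by blast
  have "A $ i $ j = (\<Sum>l\<in>insert p S. (w(p := v)) l $ i * (w(p := v)) l $ j)" for i j
  proof -
    have "(\<Sum>l\<in>S. (w(p := v)) l $ i * (w(p := v)) l $ j) = B $ i $ j"
      unfolding w using insert.hyps by (intro sum.cong) auto
    then show ?thesis using insert.hyps by (simp add: B_def)
  qed
  then show ?case by blast
qed

lemma pos_def_matrix_rank_one_sum:
  fixes A :: "real^'d^'d"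
  assumes "pos_def_matrix A"
  obtains v :: "'d \<Rightarrow> real^'d" where "\<And>i j. A $ i $ j = (\<Sum>l\<in>UNIV. v l $ i * v l $ j)"
  using rank_one_decomposition_on[of UNIV A] assms by (auto simp: pos_def_matrix_def)

text \<open>Definiteness leaves only zero in the kernel, and an injective linear endomap of a
  finite-dimensional space is onto. The solution \<open>a\<close> supplies the coefficients of the
  linear response that produces a prescribed cross moment.\<close>

lemma pos_def_matrix_surj:
  fixes A :: "real^'d^'d"
  assumes "pos_def_matrix A"
  obtains a where "A *v a = m"
proof -
  have "inj ((*v) A)"
    unfolding linear_injective_0[OF matrix_vector_mul_linear]
    using assms by (metis inner_zero_right less_irrefl pos_def_matrix_def)
  then have "surj ((*v) A)"
    by (intro linear_inj_imp_surj matrix_vector_mul_linear)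
  then show thesis by (metis that surjD)
qed

text \<open>If the response is \<open>a\<close> applied to the covariate, its cross moment is
  \<open>A *v a\<close>, so solving \<open>A *v a = m\<close> reduces the task to the second moment
  matrix. For the latter the rank-one factors of \<open>A\<close> serve as atoms, and finite support
  makes every integrability condition automatic.\<close>

lemma exists_measure_with_moments:
  fixes A :: "real^'d^'d"
  assumes "pos_def_matrix A"
  obtains \<mu> :: "((real^'d) \<times> real) measure"
  where "sets \<mu> = sets borel" "sq_integrable_pair \<mu> fst snd"
    "second_moment \<mu> fst = A" "cross_moment \<mu> fst snd = m"
proof -
  obtain v :: "'d \<Rightarrow> real^'d" where v: "\<And>i j. A $ i $ j = (\<Sum>l\<in>UNIV. v l $ i * v l $ j)"
    using pos_def_matrix_rank_one_sum[OF assms] by blast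
  obtain a where a: "A *v a = m"
    using pos_def_matrix_surj[OF assms] by blast
  \<comment> \<open>Each atom has probability one over the dimension; scaling it by the square root
    of the dimension cancels that weight in every quadratic moment.\<close>
  define c where "c = sqrt (real CARD('d))"
  have cc: "c * c = real CARD('d)" by (simp add: c_def)
  define P where "P = measure_pmf (pmf_of_set (UNIV :: 'd set))"
  define Z where "Z l = (c *\<^sub>R v l, a \<bullet> (c *\<^sub>R v l))" for l
  define \<mu> where "\<mu> = distr P borel Z"
  have Z: "Z \<in> P \<rightarrow>\<^sub>M borel" by (simp add: P_def)
  have integral: "(LINT z|\<mu>. f z) = (\<Sum>l\<in>UNIV. f (Z l)) / real CARD('d)"
    if "f \<in> borel_measurable borel" for f :: "(real^'d) \<times> real \<Rightarrow> real"
    using that Z by (simp add: \<mu>_def integral_distr P_def integral_pmf_of_set)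
  have integrable: "integrable \<mu> f"
    if "f \<in> borel_measurable borel" for f :: "(real^'d) \<times> real \<Rightarrow> real"
    using that Z by (simp add: \<mu>_def integrable_distr_eq P_def integrable_measure_pmf_finite)
  have fst_m[measurable]: "fst \<in> borel_measurable (borel :: ((real^'d) \<times> real) measure)"
    and snd_m[measurable]: "snd \<in> borel_measurable (borel :: ((real^'d) \<times> real) measure)"
    by (auto intro!: borel_measurable_continuous_onI continuous_intros)
  have nth_m[measurable]:
    "(\<lambda>z. fst z $ i) \<in> borel_measurable (borel :: ((real^'d) \<times> real) measure)" for i
    by (rule borel_measurable_vec_nth_comp) simp
  show thesis
  proof (rule that)
    show "sets \<mu> = sets borel" by (simp add: \<mu>_def)
    have "prob_space \<mu>"
      unfolding \<mu>_def P_def by (rule prob_space.prob_space_distr) (auto simp: measure_pmf.prob_space_axioms)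
    then show "sq_integrable_pair \<mu> fst snd"
      unfolding sq_integrable_pair_def
      by (auto intro!: integrable) (simp_all add: \<mu>_def)
    have "(LINT z|\<mu>. fst z $ i * fst z $ j) = A $ i $ j" for i j
    proof -
      have "(LINT z|\<mu>. fst z $ i * fst z $ j) = (\<Sum>l\<in>UNIV. (c * c) * (v l $ i * v l $ j)) / real CARD('d)"
        by (subst integral) (simp_all add: Z_def mult_ac)
      also have "\<dots> = A $ i $ j"
        unfolding cc sum_distrib_left[symmetric] v by simp
      finally show ?thesis .
    qed
    then show "second_moment \<mu> fst = A"
      by (simp add: second_moment_def vec_eq_iff)
    have "(LINT z|\<mu>. fst z $ i * snd z) = m $ i" for i
    proof -
      have "(LINT z|\<mu>. fst z $ i * snd z) = (\<Sum>l\<in>UNIV. (c * c) * (v l $ i * (a \<bullet> v l))) / real CARD('d)"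
        by (subst integral) (simp_all add: Z_def mult_ac)
      also have "\<dots> = (\<Sum>l\<in>UNIV. v l $ i * (a \<bullet> v l))"
        unfolding cc sum_distrib_left[symmetric] by simp
      also have "\<dots> = (\<Sum>l\<in>UNIV. \<Sum>j\<in>UNIV. v l $ i * v l $ j * a $ j)"
        by (simp add: inner_vec_def sum_distrib_left mult_ac)
      \<comment> \<open>After the two sums are exchanged, the inner sum over the atoms is an entry
        of \<open>A\<close>.\<close>
      also have "\<dots> = (A *v a) $ i"
        unfolding matrix_vector_mult_def
        by (subst sum.swap) (simp add: v sum_distrib_right)
      finally show ?thesis by (simp add: a)
    qed
    then show "cross_moment \<mu> fst snd = m"
      by (simp add: cross_moment_def vec_eq_iff)
  qed
qed

section \<open>Coercivity and strict convexity of the penalised quadratic\<close>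

lemma pos_def_matrix_coercive:
  fixes A :: "real^'d^'d"
  assumes "pos_def_matrix A"
  obtains c where "c > 0" "\<And>x. x \<bullet> (A *v x) \<ge> c * (norm x)\<^sup>2"
proof -
  let ?q = "\<lambda>x. x \<bullet> (A *v x)"
  have "sphere 0 1 \<noteq> ({} :: (real^'d) set)"
    by simp
  moreover have "continuous_on (sphere 0 1) ?q"
    by (intro continuous_intros linear_continuous_on linear_linear[THEN iffD2] matrix_vector_mul_linear)
  \<comment> \<open>The minimum of the form on the compact unit sphere is the coercivity constant:
    it is positive by definiteness, and homogeneity of degree two carries the bound to all
    vectors.\<close>
  ultimately obtain z where z: "z \<in> sphere 0 1" "\<And>y. y \<in> sphere 0 1 \<Longrightarrow> ?q z \<le> ?q y"
    using continuous_attains_inf[OF compact_sphere, of 0 1 ?q] by blast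
  show thesis
  proof
    have "z \<noteq> 0" using z(1) by auto
    with assms show "?q z > 0" by (simp add: pos_def_matrix_def)
    show "?q x \<ge> ?q z * (norm x)\<^sup>2" for x
    proof (cases "x = 0")
      case False
      define y where "y = (1 / norm x) *\<^sub>R x"
      have x: "x = norm x *\<^sub>R y" using False by (simp add: y_def)
      have "?q z \<le> ?q y" using False by (intro z(2)) (simp add: y_def)
      then have "?q z * (norm x)\<^sup>2 \<le> ?q y * (norm x)\<^sup>2"
        by (rule mult_right_mono) simp
      also have "\<dots> = ?q (norm x *\<^sub>R y)"
        by (simp add: matrix_vector_mult_scaleR power2_eq_square)
      also have "\<dots> = ?q x"
        by (simp only: x[symmetric])
      finally show ?thesis .
    qed simp
  qed
qed

text \<open>Existence: the quadratic growth beats the linear term outside a ball, so a minimizer on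
  that compact ball is global. Uniqueness: at the midpoint of two distinct minimizers the quadratic
  part is strictly below the average, while the linear term and the penalty are at most their
  averages.\<close>

lemma penalized_quadratic_unique_minimizer:
  fixes A :: "real^'d^'d"
  assumes A: "pos_def_matrix A" and r: "\<And>j. r j \<ge> 0"
  shows "\<exists>!x. is_arg_min (\<lambda>x. x \<bullet> (A *v x) / 2 - x \<bullet> b + (\<Sum>j\<in>UNIV. \<bar>x $ j\<bar> * r j)) (\<lambda>_. True) x"
proof -
  let ?q = "\<lambda>x. x \<bullet> (A *v x)"
  define p where "p x = (\<Sum>j\<in>UNIV. \<bar>x $ j\<bar> * r j)" for x :: "real^'d"
  define f where "f x = ?q x / 2 - x \<bullet> b + p x" for x
  obtain c where c: "c > 0" "\<And>x. ?q x \<ge> c * (norm x)\<^sup>2"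
    using pos_def_matrix_coercive[OF A] by blast
  \<comment> \<open>This is the radius beyond which \<open>c * (norm x)\<^sup>2 / 2\<close> exceeds
    \<open>norm x * norm b\<close>.\<close>
  define R where "R = 2 * norm b / c"
  have "R \<ge> 0" using c by (simp add: R_def)
  have p0: "p x \<ge> 0" for x
    unfolding p_def by (intro sum_nonneg mult_nonneg_nonneg r) simp
  have cont: "continuous_on (cball 0 R) f"
    unfolding f_def p_def
    by (intro continuous_intros linear_continuous_on linear_linear[THEN iffD2] matrix_vector_mul_linear)
      auto
  obtain z where z: "\<And>y. y \<in> cball 0 R \<Longrightarrow> f z \<le> f y"
    using continuous_attains_inf[OF compact_cball _ cont] \<open>R \<ge> 0\<close> by (metis cball_eq_empty not_less)
  have "f z \<le> f x" for x
  proof (cases "norm x \<le> R")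
    case False
    have "f z \<le> f 0" using \<open>R \<ge> 0\<close> by (intro z) simp
    also have "f 0 = 0" by (simp add: f_def p_def)
    \<comment> \<open>Half of this product is the lower bound for \<open>f x\<close> given by
      coercivity, the Cauchy-Schwarz inequality and nonnegativity of the penalty. Outside the ball
      \<open>f\<close> is thus at least its value at the origin.\<close>
    also have "0 \<le> norm x * (c * norm x - 2 * norm b)"
      using False c(1) by (intro mult_nonneg_nonneg) (auto simp: R_def field_simps)
    then have "0 \<le> c * (norm x)\<^sup>2 / 2 - norm x * norm b"
      by (simp add: power2_eq_square algebra_simps)
    also have "\<dots> \<le> f x"
      using c(2)[of x] p0[of x] norm_cauchy_schwarz[of x b] by (simp add: f_def)
    finally show ?thesis .
  qed (auto intro: z)
  then have ex: "is_arg_min f (\<lambda>_. True) z" by (auto simp: is_arg_min_def not_less)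
  have "x = y" if x: "\<And>w. f x \<le> f w" and y: "\<And>w. f y \<le> f w" for x y
  proof (rule ccontr)
    assume "x \<noteq> y"
    let ?m = "(1/2) *\<^sub>R (x + y)"
    have "?q ((1/2) *\<^sub>R (x - y)) > 0"
    proof -
      have "(1/2) *\<^sub>R (x - y) \<noteq> 0" using \<open>x \<noteq> y\<close> by simp
      with A show ?thesis unfolding pos_def_matrix_def by blast
    qed
    \<comment> \<open>This is the parallelogram law for the form; the term in \<open>x - y\<close>
      is the strict gain at the midpoint.\<close>
    moreover have "?q ?m + ?q ((1/2) *\<^sub>R (x - y)) = (?q x + ?q y) / 2"
    proof -
      have half: "?q ((1/2) *\<^sub>R w) = ?q w / 4" for w
        by (simp add: matrix_vector_mult_scaleR)
      have "?q (x + y) + ?q (x - y) = 2 * ?q x + 2 * ?q y"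
        by (simp add: matrix_vector_mult_diff_distrib matrix_vector_right_distrib
            inner_add_left inner_add_right inner_diff_left inner_diff_right)
      then show ?thesis unfolding half by simp
    qed
    moreover have "p ?m \<le> (p x + p y) / 2"
    proof -
      have "p ?m \<le> (\<Sum>j\<in>UNIV. (\<bar>x $ j\<bar> * r j + \<bar>y $ j\<bar> * r j) / 2)"
        unfolding p_def
      proof (rule sum_mono)
        fix j
        have "\<bar>?m $ j\<bar> \<le> (\<bar>x $ j\<bar> + \<bar>y $ j\<bar>) / 2" by simp
        from mult_right_mono[OF this r[of j]]
        show "\<bar>?m $ j\<bar> * r j \<le> (\<bar>x $ j\<bar> * r j + \<bar>y $ j\<bar> * r j) / 2"
          by (simp add: algebra_simps)
      qed
      then show ?thesis by (simp add: p_def sum.distrib sum_divide_distrib[symmetric])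
    qed
    moreover have "?m \<bullet> b = (x \<bullet> b + y \<bullet> b) / 2"
      by (simp add: inner_add_left)
    ultimately have "f ?m < (f x + f y) / 2"
      by (simp add: f_def field_simps)
    then show False using x[of ?m] y[of ?m] by simp
  qed
  then have "\<exists>!x. is_arg_min f (\<lambda>_. True) x"
    using ex by (intro ex1I[of _ z]) (auto simp: is_arg_min_def not_less)
  then show ?thesis unfolding f_def[abs_def] p_def .
qed

section \<open>Averaging over the environments\<close>

lemma matrix_vector_mult_sum_left:
  fixes A :: "'e \<Rightarrow> real^'n^'m"
  shows "(\<Sum>e\<in>E. A e) *v x = (\<Sum>e\<in>E. A e *v x)"
  by (induction E rule: infinite_finite_induct) (simp_all add: matrix_vector_mult_add_rdistrib)

lemma pos_def_matrix_average:
  fixes A :: "'e \<Rightarrow> real^'d^'d"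
  assumes "finite E" "E \<noteq> {}" "\<And>e. e \<in> E \<Longrightarrow> pos_def_matrix (A e)"
  shows "pos_def_matrix ((1 / real (card E)) *\<^sub>R (\<Sum>e\<in>E. A e))"
  unfolding pos_def_matrix_def
proof (intro conjI allI impI)
  show "transpose ((1 / real (card E)) *\<^sub>R (\<Sum>e\<in>E. A e)) = (1 / real (card E)) *\<^sub>R (\<Sum>e\<in>E. A e)"
    using assms(3) transpose_sym_nth
    by (simp add: transpose_def vec_eq_iff pos_def_matrix_def)
  show "0 < x \<bullet> (((1 / real (card E)) *\<^sub>R (\<Sum>e\<in>E. A e)) *v x)" if "x \<noteq> 0" for x
    using assms that card_gt_0_iff[of E]
    by (auto simp: scaleR_matrix_vector_assoc[symmetric] matrix_vector_mult_sum_left inner_sum_right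
        pos_def_matrix_def intro!: mult_pos_pos divide_pos_pos sum_pos)
qed

lemma invariance_weight_nonneg:
  fixes X :: "'e \<Rightarrow> 'a \<Rightarrow> real^'d"
  assumes "1 \<le> k"
  shows "invariance_weight E M X Y k j \<ge> 0"
proof -
  \<comment> \<open>\<open>Min\<close> carries information only on a nonempty set; since
    \<open>k\<close> is at least 1, the singleton of \<open>j\<close> is always admissible.\<close>
  have "{j} \<in> {S. j \<in> S \<and> card S \<le> k}" using assms by simp
  then show ?thesis
    unfolding invariance_weight_def
    by (subst real_sqrt_ge_0_iff, subst Min_ge_iff)
      (auto intro!: divide_nonneg_nonneg sum_nonneg simp del: mem_Collect_eq)
qed

text \<open>The risks enter linearly, so averaging them replaces the moments of the environments by
  the pooled ones. The last summand is free of \<open>\<beta>\<close>; what precedes it has the form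
  handled by \<open>penalized_quadratic_unique_minimizer\<close>.\<close>

lemma Q_obj_eq:
  fixes X :: "'e \<Rightarrow> 'a \<Rightarrow> real^'d"
  assumes "\<And>e. e \<in> E \<Longrightarrow> sq_integrable_pair (M e) (X e) (Y e)"
  shows "Q_obj E M X Y k \<gamma> \<beta> =
      \<beta> \<bullet> (avg_second_moment E M X *v \<beta>) / 2 - \<beta> \<bullet> avg_cross_moment E M X Y
      + (\<Sum>j\<in>UNIV. \<bar>\<beta> $ j\<bar> * (\<gamma> * invariance_weight E M X Y k j))
      + (\<Sum>e\<in>E. LINT \<omega>|M e. (Y e \<omega>)\<^sup>2) / (2 * real (card E))"
proof -
  define q where "q = (\<Sum>e\<in>E. \<beta> \<bullet> (second_moment (M e) (X e) *v \<beta>))"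
  define l where "l = (\<Sum>e\<in>E. \<beta> \<bullet> cross_moment (M e) (X e) (Y e))"
  define c where "c = (\<Sum>e\<in>E. LINT \<omega>|M e. (Y e \<omega>)\<^sup>2)"
  have "(\<Sum>e\<in>E. sq_risk (M e) (X e) (Y e) \<beta>) = q - 2 * l + c"
    using assms by (simp add: sq_risk_eq q_def l_def c_def sum.distrib sum_subtractf sum_distrib_left)
  moreover have "\<beta> \<bullet> (avg_second_moment E M X *v \<beta>) = q / real (card E)"
    by (simp add: avg_second_moment_def scaleR_matrix_vector_assoc[symmetric]
        matrix_vector_mult_sum_left inner_sum_right q_def)
  moreover have "\<beta> \<bullet> avg_cross_moment E M X Y = l / real (card E)"
    by (simp add: avg_cross_moment_def inner_sum_right l_def)
  moreover have "\<gamma> * (\<Sum>j\<in>UNIV. \<bar>\<beta> $ j\<bar> * invariance_weight E M X Y k j) =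
      (\<Sum>j\<in>UNIV. \<bar>\<beta> $ j\<bar> * (\<gamma> * invariance_weight E M X Y k j))"
    by (simp add: sum_distrib_left mult.left_commute)
  ultimately show ?thesis
    by (simp add: Q_obj_def c_def[symmetric] add_divide_distrib diff_divide_distrib)
qed

section \<open>The inner maximum and its comparison with the objective\<close>

lemma excess_risk_eq:
  assumes "\<mu> \<in> uncertainty_set E M X Y k \<gamma>"
  shows "excess_risk \<beta> \<mu> =
    \<beta> \<bullet> (avg_second_moment E M X *v \<beta>) - 2 * (\<beta> \<bullet> cross_moment \<mu> fst snd)"
  using assms by (simp only: excess_risk_def excess_integral uncertainty_set_def mem_Collect_eq)

text \<open>On the uncertainty set only the cross moment varies, and the excess risk is affine in
  it. Its worst case over a box is found coordinate by coordinate, and the half-widths turn into a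
  weighted absolute-value penalty.\<close>

lemma excess_risk_attained_max:
  fixes X :: "'e \<Rightarrow> 'a \<Rightarrow> real^'d"
    and Y :: "'e \<Rightarrow> 'a \<Rightarrow> real" and \<beta> :: "real^'d"
  assumes pd: "pos_def_matrix (avg_second_moment E M X)" and "1 \<le> k" and "\<gamma> \<ge> 0"
  defines "U \<equiv> uncertainty_set E M X Y k \<gamma>"
  defines "V \<equiv> \<beta> \<bullet> (avg_second_moment E M X *v \<beta>) - 2 * (\<beta> \<bullet> avg_cross_moment E M X Y)
      + 2 * (\<Sum>j\<in>UNIV. \<bar>\<beta> $ j\<bar> * (\<gamma> * invariance_weight E M X Y k j))"
  shows "\<exists>\<mu>. is_arg_max (excess_risk \<beta>) (\<lambda>\<mu>. \<mu> \<in> U) \<mu>" and "max_over U (excess_risk \<beta>) = V"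
proof -
  define r where "r j = \<gamma> * invariance_weight E M X Y k j" for j
  define u where "u = avg_cross_moment E M X Y"
  have r: "r j \<ge> 0" for j
    using assms(2,3) by (simp add: r_def invariance_weight_nonneg)
  have upper: "excess_risk \<beta> \<mu> \<le> V" if "\<mu> \<in> U" for \<mu>
  proof -
    let ?m = "cross_moment \<mu> fst snd"
    have "\<beta> \<bullet> u - \<beta> \<bullet> ?m = (\<Sum>j\<in>UNIV. \<beta> $ j * (u $ j - ?m $ j))"
      by (simp add: inner_vec_def right_diff_distrib sum_subtractf)
    also have "\<dots> \<le> (\<Sum>j\<in>UNIV. \<bar>\<beta> $ j\<bar> * r j)"
    proof (rule sum_mono)
      fix j
      have "\<bar>u $ j - ?m $ j\<bar> \<le> r j"
        using that by (simp add: U_def uncertainty_set_def r_def u_def abs_minus_commute)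
      then have "\<bar>\<beta> $ j\<bar> * \<bar>u $ j - ?m $ j\<bar> \<le> \<bar>\<beta> $ j\<bar> * r j"
        by (rule mult_left_mono) simp
      then show "\<beta> $ j * (u $ j - ?m $ j) \<le> \<bar>\<beta> $ j\<bar> * r j"
        by (simp add: abs_mult[symmetric])
    qed
    finally show ?thesis
      using that by (simp add: U_def excess_risk_eq V_def u_def r_def)
  qed
  \<comment> \<open>Each coordinate is moved to the end of its interval that lowers
    \<open>\<beta> \<bullet> m\<close>. Where \<open>\<beta> $ j\<close> is zero, \<open>sgn\<close>
    selects the centre, which changes nothing because that coordinate has no weight in the inner
    product.\<close>
  define m where "m = (\<chi> j. u $ j - sgn (\<beta> $ j) * r j)"
  obtain \<mu> :: "((real^'d) \<times> real) measure" where \<mu>: "sets \<mu> = sets borel"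
    "sq_integrable_pair \<mu> fst snd" "second_moment \<mu> fst = avg_second_moment E M X"
    "cross_moment \<mu> fst snd = m"
    using exists_measure_with_moments[OF pd] by blast
  have "\<bar>m $ j - u $ j\<bar> \<le> r j" for j
    using r[of j] by (simp add: m_def abs_mult abs_sgn_eq)
  with \<mu> have in_U: "\<mu> \<in> U"
    by (simp add: U_def uncertainty_set_def r_def u_def)
  have "\<beta> \<bullet> m = (\<Sum>j\<in>UNIV. \<beta> $ j * u $ j - \<beta> $ j * sgn (\<beta> $ j) * r j)"
    by (simp add: inner_vec_def m_def right_diff_distrib mult_ac)
  also have "\<dots> = \<beta> \<bullet> u - (\<Sum>j\<in>UNIV. \<bar>\<beta> $ j\<bar> * r j)"
    by (simp add: sum_subtractf inner_vec_def abs_sgn)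
  finally have value_V: "excess_risk \<beta> \<mu> = V"
    using in_U \<mu>(4) by (simp add: U_def excess_risk_eq V_def u_def r_def)
  show "\<exists>\<mu>. is_arg_max (excess_risk \<beta>) (\<lambda>\<mu>. \<mu> \<in> U) \<mu>"
    using in_U upper value_V by (auto simp: is_arg_max_def not_less intro!: exI[of _ \<mu>])
  \<comment> \<open>The \<open>GREATEST\<close> in \<open>max_over\<close> is pinned down because
    the upper bound \<open>V\<close> is itself a value, taken at the law constructed above.\<close>
  show "max_over U (excess_risk \<beta>) = V"
    unfolding max_over_def using in_U upper value_V by (intro Greatest_equality) auto
qed

theorem theorem3p2:
  fixes E :: "'e set"
    and M :: "'e \<Rightarrow> 'a measure"
    and X :: "'e \<Rightarrow> 'a \<Rightarrow> real^'d"
    and Y :: "'e \<Rightarrow> 'a \<Rightarrow> real"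
    and k :: nat
    and \<gamma> :: real
  assumes "finite E" and "E \<noteq> {}"
    and "\<And>e. e \<in> E \<Longrightarrow> sq_integrable_pair (M e) (X e) (Y e)"
    and "\<And>e. e \<in> E \<Longrightarrow> pos_def_matrix (second_moment (M e) (X e))"
    and "\<And>j. avg_second_moment E M X $ j $ j = 1"
    and "1 \<le> k" and "k \<le> CARD('d)"
    and "\<gamma> \<ge> 0"
  shows "(\<exists>!\<beta>. is_arg_min (Q_obj E M X Y k \<gamma>) (\<lambda>_. True) \<beta>) \<and>
         (\<forall>\<beta>. \<exists>\<mu>. is_arg_max (excess_risk \<beta>) (\<lambda>\<mu>. \<mu> \<in> uncertainty_set E M X Y k \<gamma>) \<mu>) \<and>
         (\<forall>\<beta>. is_arg_min (Q_obj E M X Y k \<gamma>) (\<lambda>_. True) \<beta> \<longleftrightarrow>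
              is_arg_min (\<lambda>b. max_over (uncertainty_set E M X Y k \<gamma>) (excess_risk b)) (\<lambda>_. True) \<beta>)"
proof -
  let ?Q = "Q_obj E M X Y k \<gamma>"
  let ?G = "\<lambda>b. max_over (uncertainty_set E M X Y k \<gamma>) (excess_risk b)"
  let ?C = "(\<Sum>e\<in>E. LINT \<omega>|M e. (Y e \<omega>)\<^sup>2) / (2 * real (card E))"
  have pd: "pos_def_matrix (avg_second_moment E M X)"
    unfolding avg_second_moment_def using assms(1,2,4) by (rule pos_def_matrix_average)
  note Q = Q_obj_eq[where k = k and \<gamma> = \<gamma>, OF assms(3)]
  note max = excess_risk_attained_max[OF pd assms(6,8)]
  have "\<exists>!\<beta>. is_arg_min (\<lambda>\<beta>. \<beta> \<bullet> (avg_second_moment E M X *v \<beta>) / 2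
      - \<beta> \<bullet> avg_cross_moment E M X Y
      + (\<Sum>j\<in>UNIV. \<bar>\<beta> $ j\<bar> * (\<gamma> * invariance_weight E M X Y k j))) (\<lambda>_. True) \<beta>"
    using assms(6,8)
    by (intro penalized_quadratic_unique_minimizer[OF pd] mult_nonneg_nonneg invariance_weight_nonneg)
  then have "\<exists>!\<beta>. is_arg_min ?Q (\<lambda>_. True) \<beta>"
    by (simp add: is_arg_min_def Q)
  \<comment> \<open>Doubling and shifting by a constant preserve the order of values, so both
    objectives have the same minimizers.\<close>
  moreover have "?G b = 2 * ?Q b - 2 * ?C" for b
    by (simp add: max(2) Q algebra_simps)
  then have "is_arg_min ?Q (\<lambda>_. True) \<beta> \<longleftrightarrow> is_arg_min ?G (\<lambda>_. True) \<beta>" for \<beta>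
    by (simp add: is_arg_min_def)
  ultimately show ?thesis
    using max(1) by blast
qed

end
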